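(* Let $\mathcal H$ be an infinite-dimensional separable complex Hilbert space, let $T\in\mathcal B(\mathcal H)$ and $\mu\in\mathbb C$. The following statements are equivalent. (a) $\mu$ belongs to the essential numerical range $W_e(T)$, i.e. there exists an orthonormal system $(f_n)_{n\in\mathbb N}$ in $\mathcal H$ such that $\lim_{n\to\infty}\langle f_n,Tf_n\rangle=\mu$. (b) There exists an orthonormal system $(f_n)_{n\in\mathbb N}$ in $\mathcal H$ such that $\displaystyle\lim_{n\to\infty}\frac1n\sum_{j=1}^n\langle f_j,Tf_j\rangle=\mu$. (c) There exists an orthonormal basis $(e_n)_{n\in\mathbb N}$ of $\mathcal H$ such that $\displaystyle\lim_{n\to\infty}\frac1n\sum_{j=1}^n\langle e_j,Te_j\rangle=\mu$.
   Context: $\mathcal B(\mathcal H)$ denotes the bounded linear operators on $\mathcal H$. The essential numerical range of $T\in\mathcal B(\mathcal H)$ is $W_e(T):=\{\lim_{n\to\infty}\langle f_n,Tf_n\rangle\mid(f_n)_{n\in\mathbb N}\text{ is an orthonormal system in }\mathcal H\}$ (limits over those orthonormal sequences for which the limit exists). The scalar product is conjugate linear in the first and linear in the second argument. *)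

theory Defs
  imports "HOL-Analysis.Analysis"
begin

section \<open>Complex Hilbert spaces\<close>

class scaleC = scaleR +
  fixes scaleC :: "complex \<Rightarrow> 'a \<Rightarrow> 'a" (infixr \<open>*\<^sub>C\<close> 75)
  assumes scaleR_scaleC: "r *\<^sub>R x = complex_of_real r *\<^sub>C x"

class complex_vector = scaleC + ab_group_add +
  assumes scaleC_add_right: "a *\<^sub>C (x + y) = a *\<^sub>C x + a *\<^sub>C y"
    and scaleC_add_left: "(a + b) *\<^sub>C x = a *\<^sub>C x + b *\<^sub>C x"
    and scaleC_scaleC: "a *\<^sub>C b *\<^sub>C x = (a * b) *\<^sub>C x"
    and scaleC_one: "1 *\<^sub>C x = x"

global_interpretation complex_vector: vector_space "scaleC :: complex \<Rightarrow> 'a \<Rightarrow> 'a :: complex_vector"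
  defines cspan = complex_vector.span
  by unfold_locales (simp_all add: scaleC_add_right scaleC_add_left scaleC_scaleC scaleC_one)

text \<open>The inner product is conjugate linear in the first and linear in the second argument.
  The value \<open>cinner x x\<close> is real by \<open>cinner_commute\<close>, so positivity can be stated through
  its real part. The underlying real normed space provides the norm, metric and topology.\<close>

class complex_inner = complex_vector + real_normed_vector +
  fixes cinner :: "'a \<Rightarrow> 'a \<Rightarrow> complex"
  assumes cinner_commute: "cinner x y = cnj (cinner y x)"
    and cinner_add_right: "cinner x (y + z) = cinner x y + cinner x z"
    and cinner_scaleC_right: "cinner x (c *\<^sub>C y) = c * cinner x y"
    and cinner_ge_zero: "0 \<le> Re (cinner x x)"
    and cinner_eq_zero_iff: "cinner x x = 0 \<longleftrightarrow> x = 0"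
    and norm_eq_sqrt_cinner: "norm x = sqrt (Re (cinner x x))"

class chilbert_space = complex_inner + complete_space

definition infinite_dimensional :: "'a::complex_vector itself \<Rightarrow> bool" where
  "infinite_dimensional _ \<longleftrightarrow> \<not> (\<exists>B :: 'a set. finite B \<and> cspan B = UNIV)"

definition bounded_clinear :: "('a::complex_inner \<Rightarrow> 'b::complex_inner) \<Rightarrow> bool" where
  "bounded_clinear T \<longleftrightarrow>
     Vector_Spaces.linear scaleC scaleC T \<and> (\<exists>K. \<forall>x. norm (T x) \<le> norm x * K)"

section \<open>Orthonormal sequences and the essential numerical range\<close>

definition orthonormal_system :: "(nat \<Rightarrow> 'a::complex_inner) \<Rightarrow> bool" where
  "orthonormal_system f \<longleftrightarrow> (\<forall>m n. cinner (f m) (f n) = (if m = n then 1 else 0))"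

definition orthonormal_basis :: "(nat \<Rightarrow> 'a::complex_inner) \<Rightarrow> bool" where
  "orthonormal_basis e \<longleftrightarrow> orthonormal_system e \<and> closure (cspan (range e)) = UNIV"

definition essential_numerical_range :: "('a::complex_inner \<Rightarrow> 'a) \<Rightarrow> complex set" where
  "essential_numerical_range T =
     {\<mu>. \<exists>f. orthonormal_system f \<and> (\<lambda>n. cinner (f n) (T (f n))) \<longlonglongrightarrow> \<mu>}"

text \<open>Sequences are indexed from 0, so the mean over the first \<open>n\<close> members
  \<open>f 0, \<dots>, f (n - 1)\<close> is a sum over \<open>j < n\<close>. Its value at \<open>n = 0\<close> is 0 and is
  irrelevant for limits.\<close>

definition diagonal_mean :: "('a::complex_inner \<Rightarrow> 'a) \<Rightarrow> (nat \<Rightarrow> 'a) \<Rightarrow> nat \<Rightarrow> complex" where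
  "diagonal_mean T f n = 1 / of_nat n * (\<Sum>j<n. cinner (f j) (T (f j)))"

end

theory Submission
  imports Defs
begin

text \<open>
  Membership of \<open>\<mu>\<close> in the essential numerical range is a property of the tails of orthonormal
  systems, and the two nontrivial implications of the theorem pass between it and means of
  diagonal entries.

  From means to limits: suppose the diagonal means of \<open>T\<close> along \<open>f\<close> converge to \<open>\<mu>\<close>. The average
  of the diagonal entries over the dyadic block \<open>2 ^ k \<le> j < 2 ^ Suc k\<close> is twice the mean of
  length \<open>2 ^ Suc k\<close> minus the mean of length \<open>2 ^ k\<close>, so it also tends to \<open>2 * \<mu> - \<mu> = \<mu>\<close>. By the
  argument of the Toeplitz--Hausdorff theorem, such an average is itself attained as
  \<open>cinner z (T z)\<close> at a unit vector \<open>z\<close> in the span of the block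
  (\<open>diagonal_average_in_numerical_range\<close>). Vectors from different blocks are orthogonal, so
  choosing one from each block gives an orthonormal system that realises \<open>\<mu>\<close> as a limit.

  From limits to a basis: an orthonormal system is weakly null, so its late members are almost
  orthogonal to any given finite family. Hence there are unit vectors exactly
  orthogonal to that family at which the quadratic form of \<open>T\<close> is as close to \<open>\<mu>\<close> as desired
  (\<open>essential_numerical_range_orthogonal_unit\<close>). A basis is now built recursively: at most
  positions such a vector is appended, and at the \<open>k\<close>-th square number one appends instead the
  Gram--Schmidt vector that puts the \<open>k\<close>-th element of a countable dense set into the span.
  The squares have density zero and the diagonal entries are bounded, so the exceptional positions
  do not affect the limit of the means, while the span becomes dense.

  Every orthonormal basis is an orthonormal system, which closes the circle.
\<close>

section \<open>Inner products and orthonormal families\<close>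

lemma cinner_add_left: "cinner (x + y) z = cinner x z + cinner y z"
  using cinner_commute[of "x + y" z] cinner_commute[of x z] cinner_commute[of y z]
  by (simp add: cinner_add_right)

lemma cinner_scaleC_left: "cinner (c *\<^sub>C x) y = cnj c * cinner x y"
  using cinner_commute[of "c *\<^sub>C x" y] cinner_commute[of x y]
  by (simp add: cinner_scaleC_right)

lemma cinner_zero_right [simp]: "cinner x 0 = 0"
  using cinner_add_right[of x 0 0] by simp

lemma cinner_zero_left [simp]: "cinner 0 x = 0"
  using cinner_commute[of 0 x] by simp

lemma cinner_diff_right: "cinner x (y - z) = cinner x y - cinner x z"
  using cinner_add_right[of x "y - z" z] by simp

lemma cinner_diff_left: "cinner (x - y) z = cinner x z - cinner y z"
  using cinner_add_left[of "x - y" y z] by simp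

lemma cinner_sum_right: "cinner x (\<Sum>i\<in>A. f i) = (\<Sum>i\<in>A. cinner x (f i))"
  by (induction A rule: infinite_finite_induct) (simp_all add: cinner_add_right)

lemma cinner_sum_left: "cinner (\<Sum>i\<in>A. f i) x = (\<Sum>i\<in>A. cinner (f i) x)"
  by (induction A rule: infinite_finite_induct) (simp_all add: cinner_add_left)

lemma cinner_orthogonal_sym: "cinner x y = 0 \<longleftrightarrow> cinner y x = 0"
  by (metis cinner_commute complex_cnj_zero)

lemma cinner_self: "cinner x x = of_real ((norm x)\<^sup>2)"
proof -
  have "Im (cinner x x) = 0"
    using arg_cong[OF cinner_commute[of x x], of Im] by simp
  then show ?thesis
    by (simp add: complex_eq_iff norm_eq_sqrt_cinner cinner_ge_zero)
qed

lemma norm_scaleC: "norm (c *\<^sub>C x) = cmod c * norm (x :: 'a::complex_inner)"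
proof -
  have "complex_of_real ((norm (c *\<^sub>C x))\<^sup>2) = (c * cnj c) * cinner x x"
    unfolding cinner_self[symmetric] by (simp add: cinner_scaleC_left cinner_scaleC_right mult_ac)
  also have "\<dots> = of_real ((cmod c * norm x)\<^sup>2)"
    by (simp add: cinner_self power_mult_distrib complex_norm_square[symmetric])
  finally have "complex_of_real ((norm (c *\<^sub>C x))\<^sup>2) = of_real ((cmod c * norm x)\<^sup>2)" .
  then show ?thesis
    by (simp only: of_real_eq_iff) (simp add: power2_eq_iff_nonneg)
qed

lemma norm_add_orthogonal:
  fixes x y :: "'a::complex_inner"
  assumes "cinner x y = 0"
  shows "(norm (x + y))\<^sup>2 = (norm x)\<^sup>2 + (norm y)\<^sup>2"
proof -
  have "complex_of_real ((norm (x + y))\<^sup>2) = of_real ((norm x)\<^sup>2 + (norm y)\<^sup>2)"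
    using assms cinner_orthogonal_sym[of x y]
    by (simp add: cinner_self[symmetric] cinner_add_left cinner_add_right del: of_real_power)
  then show ?thesis by (simp only: of_real_eq_iff)
qed

lemma norm_normalize: "x \<noteq> 0 \<Longrightarrow> norm (of_real (1 / norm x) *\<^sub>C x) = 1" for x :: "'a::complex_inner"
  by (simp add: norm_scaleC norm_divide)

definition orthonormal_on :: "'i set \<Rightarrow> ('i \<Rightarrow> 'a::complex_inner) \<Rightarrow> bool" where
  "orthonormal_on A f \<longleftrightarrow> (\<forall>i\<in>A. \<forall>j\<in>A. cinner (f i) (f j) = (if i = j then 1 else 0))"

text \<open>For finite orthonormal families this is the orthogonal projection onto their span.\<close>

definition fourier_sum :: "'i set \<Rightarrow> ('i \<Rightarrow> 'a) \<Rightarrow> 'a \<Rightarrow> 'a::complex_inner" where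
  "fourier_sum A f x = (\<Sum>i\<in>A. cinner (f i) x *\<^sub>C f i)"

lemma orthonormal_system_on: "orthonormal_system f \<Longrightarrow> orthonormal_on A f"
  by (auto simp: orthonormal_system_def orthonormal_on_def)

lemma orthonormal_system_norm: "orthonormal_system f \<Longrightarrow> norm (f n) = 1"
  by (simp add: orthonormal_system_def norm_eq_sqrt_cinner)

lemma fourier_sum_in_cspan: "fourier_sum A f x \<in> cspan (f ` A)"
  unfolding fourier_sum_def
  by (intro complex_vector.span_sum complex_vector.span_scale complex_vector.span_base) auto

lemma cinner_fourier_residual:
  assumes "finite A" "orthonormal_on A f" "j \<in> A"
  shows "cinner (f j) (x - fourier_sum A f x) = 0"
proof -
  have "cinner (f j) (fourier_sum A f x) = (\<Sum>i\<in>A. if j = i then cinner (f i) x else 0)"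
    unfolding fourier_sum_def cinner_sum_right cinner_scaleC_right
    using assms by (intro sum.cong) (auto simp: orthonormal_on_def)
  also have "\<dots> = cinner (f j) x"
    using assms by simp
  finally show ?thesis by (simp add: cinner_diff_right)
qed

lemma cinner_fourier_sum_residual:
  assumes "finite A" "orthonormal_on A f"
  shows "cinner (fourier_sum A f x) (x - fourier_sum A f x) = 0"
proof -
  define q where "q = x - fourier_sum A f x"
  have "cinner (fourier_sum A f x) q = (\<Sum>i\<in>A. cnj (cinner (f i) x) * cinner (f i) q)"
    by (simp add: fourier_sum_def cinner_sum_left cinner_scaleC_left)
  then show ?thesis
    using cinner_fourier_residual[OF assms] by (simp add: q_def)
qed

text \<open>The left-hand side is the squared norm of the projection \<open>fourier_sum A f x\<close>, and \<open>x\<close> is the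
  orthogonal sum of this projection and the residual.\<close>

lemma bessel_inequality:
  assumes "finite A" "orthonormal_on A f"
  shows "(\<Sum>i\<in>A. (cmod (cinner (f i) x))\<^sup>2) \<le> (norm x)\<^sup>2"
proof -
  define p where "p = fourier_sum A f x"
  have pf: "cinner (f i) p = cinner (f i) x" if "i \<in> A" for i
    using cinner_fourier_residual[OF assms that, of x] by (simp add: p_def cinner_diff_right)
  have "cinner p p = (\<Sum>i\<in>A. cnj (cinner (f i) x) * cinner (f i) p)"
    by (subst (1) p_def) (simp add: fourier_sum_def cinner_sum_left cinner_scaleC_left)
  also have "\<dots> = of_real (\<Sum>i\<in>A. (cmod (cinner (f i) x))\<^sup>2)"
    by (simp add: pf complex_norm_square mult.commute del: of_real_power)
  finally have "(norm p)\<^sup>2 = (\<Sum>i\<in>A. (cmod (cinner (f i) x))\<^sup>2)"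
    by (simp only: cinner_self of_real_eq_iff)
  moreover have "(norm x)\<^sup>2 = (norm p)\<^sup>2 + (norm (x - p))\<^sup>2"
    using norm_add_orthogonal[OF cinner_fourier_sum_residual[OF assms, of x]] by (simp add: p_def)
  ultimately show ?thesis by simp
qed

text \<open>Bessel's inequality for the family consisting of the single vector
  \<open>y / \<parallel>y\<parallel>\<close>.\<close>

lemma cauchy_schwarz: "cmod (cinner y x) \<le> norm y * norm x"
proof (cases "y = 0")
  case False
  define f where "f = (\<lambda>_ :: unit. of_real (1 / norm y) *\<^sub>C y)"
  have "cinner (f ()) (f ()) = 1"
    using norm_normalize[OF False] by (simp add: cinner_self f_def)
  then have "(cmod (cinner (f ()) x))\<^sup>2 \<le> (norm x)\<^sup>2"
    using bessel_inequality[of "{()}" f x] by (simp add: orthonormal_on_def)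
  then have "cmod (cinner (f ()) x) \<le> norm x"
    by (simp add: power2_le_iff_abs_le)
  then show ?thesis
    using False by (simp add: f_def cinner_scaleC_left norm_mult norm_divide field_simps)
qed simp

text \<open>By Bessel's inequality the squared coefficients form a convergent series.\<close>

lemma orthonormal_weakly_null:
  assumes "orthonormal_system f"
  shows "(\<lambda>n. cinner y (f n)) \<longlonglongrightarrow> 0"
proof -
  have "summable (\<lambda>i. (cmod (cinner (f i) y))\<^sup>2)"
    by (rule bounded_imp_summable[where B = "(norm y)\<^sup>2"])
       (auto intro!: bessel_inequality orthonormal_system_on assms)
  then have "(\<lambda>i. (cmod (cinner (f i) y))\<^sup>2) \<longlonglongrightarrow> 0"
    by (rule summable_LIMSEQ_zero)
  then have "(\<lambda>i. sqrt ((cmod (cinner (f i) y))\<^sup>2)) \<longlonglongrightarrow> sqrt 0"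
    by (rule tendsto_real_sqrt)
  then have "(\<lambda>i. cmod (cinner y (f i))) \<longlonglongrightarrow> 0"
    by (subst cinner_commute) simp
  then show ?thesis by (rule tendsto_norm_zero_cancel)
qed

lemma cinner_zero_cspan:
  assumes "\<And>b. b \<in> B \<Longrightarrow> cinner x b = 0" "y \<in> cspan B"
  shows "cinner x y = 0"
  using assms(2)
  by (induction rule: complex_vector.span_induct_alt)
     (simp_all add: cinner_add_right cinner_scaleC_right assms(1))

lemma cspan_orthogonal:
  assumes "\<And>a b. a \<in> A \<Longrightarrow> b \<in> B \<Longrightarrow> cinner a b = 0" "x \<in> cspan A" "y \<in> cspan B"
  shows "cinner x y = 0"
proof -
  have "cinner y a = 0" if "a \<in> A" for a
    using cinner_zero_cspan[of B a y] assms(1,3) that cinner_orthogonal_sym by blast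
  then show ?thesis
    using cinner_zero_cspan[of A y x] assms(2) cinner_orthogonal_sym by blast
qed

section \<open>Bounded operators\<close>

lemma bounded_clinear_add: "bounded_clinear T \<Longrightarrow> T (x + y) = T x + T y"
  by (simp add: bounded_clinear_def Vector_Spaces.linear_iff)

lemma bounded_clinear_scaleC: "bounded_clinear T \<Longrightarrow> T (c *\<^sub>C x) = c *\<^sub>C T x"
  by (simp add: bounded_clinear_def Vector_Spaces.linear_iff)

lemma bounded_clinear_diff: "bounded_clinear T \<Longrightarrow> T (x - y) = T x - T y"
  using bounded_clinear_add[of T "x - y" y] by simp

lemma bounded_clinear_bound:
  assumes "bounded_clinear T"
  obtains K where "0 \<le> K" "\<And>x. norm (T x) \<le> K * norm x"
proof -
  obtain K where K: "\<And>x. norm (T x) \<le> norm x * K"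
    using assms by (auto simp: bounded_clinear_def)
  have "norm (T x) \<le> \<bar>K\<bar> * norm x" for x
    using K[of x] by (smt (verit) mult.commute mult_left_mono norm_ge_zero)
  then show ?thesis using that[of "\<bar>K\<bar>"] by auto
qed

lemma cinner_scaleC_quadratic:
  "bounded_clinear T \<Longrightarrow> cinner (c *\<^sub>C x) (T (c *\<^sub>C x)) = of_real ((cmod c)\<^sup>2) * cinner x (T x)"
  by (simp add: bounded_clinear_scaleC cinner_scaleC_left cinner_scaleC_right complex_norm_square mult_ac
      del: of_real_power)

section \<open>The numerical range on spans of orthonormal families\<close>

text \<open>The core of the Toeplitz--Hausdorff convexity theorem, for orthogonal unit vectors. On the unit
  sphere of their span the form produces cross terms besides the convex combination; rotating
  the phase of \<open>y\<close> makes these parallel to the segment between the two values, so that the path from \<open>x\<close> to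
  the rotated \<open>y\<close> has its values on one line and meets every point of the segment by the
  intermediate value theorem.\<close>

lemma numerical_range_segment:
  fixes T :: "'a::complex_inner \<Rightarrow> 'a"
  assumes T: "bounded_clinear T" and x: "norm x = 1" and y: "norm y = 1"
    and xy: "cinner x y = 0" and t: "0 \<le> t" "t \<le> 1"
  obtains z where "z \<in> cspan {x, y}" "norm z = 1"
    "cinner z (T z) = of_real (1 - t) * cinner x (T x) + of_real t * cinner y (T y)"
proof -
  define a b c d where "a = cinner x (T x)" and "b = cinner y (T y)"
    and "c = cinner x (T y)" and "d = cinner y (T x)"
  note abcd = a_def b_def c_def d_def
  show ?thesis
  proof (cases "a = b")
    case True
    then show ?thesis
      using that[of x] x by (simp add: abcd complex_vector.span_base algebra_simps)
  next
    case False
    \<comment> \<open>The phase \<open>u\<close> makes the cross terms \<open>u * c + cnj u * d\<close> a real multiple of \<open>b - a\<close>: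
      the imaginary part of their quotient is \<open>Im (u * v)\<close>.\<close>
    define v where "v = c / (b - a) - cnj (d / (b - a))"
    define u where "u = (if v = 0 then 1 else cnj v / of_real (cmod v))"
    have u: "cmod u = 1"
      by (simp add: u_def norm_divide)
    have uv: "Im (u * v) = 0"
      by (simp add: u_def)
    define s where "s = Re (u * (c / (b - a)) + cnj u * (d / (b - a)))"
    have "u * (c / (b - a)) + cnj u * (d / (b - a)) = of_real s"
    proof (rule complex_eqI)
      have "Im (cnj u * w) = - Im (u * cnj w)" for w
        by (simp add: algebra_simps)
      then have "Im (u * (c / (b - a)) + cnj u * (d / (b - a))) = Im (u * v)"
        by (simp only: v_def right_diff_distrib plus_complex.sel minus_complex.sel)
      then show "Im (u * (c / (b - a)) + cnj u * (d / (b - a))) = Im (of_real s)"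
        by (simp only: uv Im_complex_of_real)
    qed (simp add: s_def)
    then have "(u * c + cnj u * d) / (b - a) = of_real s"
      by (simp add: add_divide_distrib)
    then have cross: "u * c + cnj u * d = of_real s * (b - a)"
      using False by (simp add: nonzero_divide_eq_eq)
    \<comment> \<open>At \<open>cos \<theta>\<close> times \<open>x\<close> plus \<open>sin \<theta> * u\<close> times \<open>y\<close> the form takes the value
      \<open>a + \<phi> \<theta> * (b - a)\<close>, which moves continuously on the line through \<open>a\<close> and \<open>b\<close>.\<close>
    define \<phi> where "\<phi> \<theta> = (sin \<theta>)\<^sup>2 + s * (cos \<theta> * sin \<theta>)" for \<theta> :: real
    have "\<exists>\<theta>\<ge>0. \<theta> \<le> pi / 2 \<and> \<phi> \<theta> = t"
    proof (rule IVT')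
      show "continuous_on {0..pi / 2} \<phi>"
        unfolding \<phi>_def by (intro continuous_intros)
    qed (use t in \<open>auto simp: \<phi>_def\<close>)
    then obtain \<theta> where \<theta>: "\<phi> \<theta> = t" by blast
    define z where "z = of_real (cos \<theta>) *\<^sub>C x + (of_real (sin \<theta>) * u) *\<^sub>C y"
    have "(norm z)\<^sup>2 = (cos \<theta>)\<^sup>2 + (sin \<theta>)\<^sup>2"
      unfolding z_def
      by (subst norm_add_orthogonal)
         (simp_all add: cinner_scaleC_left cinner_scaleC_right xy norm_scaleC norm_mult x y u)
    then have "norm z = 1"
      by (simp add: power2_eq_1_iff) (smt (verit) norm_ge_zero)
    moreover have "z \<in> cspan {x, y}"
      unfolding z_def by (intro complex_vector.span_add complex_vector.span_scale complex_vector.span_base) auto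
    moreover have "cinner z (T z) = of_real (1 - t) * a + of_real t * b"
    proof -
      have uu: "cnj u * u = 1"
        using u complex_norm_square[of u] by (simp add: mult.commute)
      have cs: "(of_real (cos \<theta>) :: complex)\<^sup>2 = 1 - (of_real (sin \<theta>))\<^sup>2"
        by (simp flip: of_real_power add: cos_squared_eq)
      have "cinner z (T z) = (of_real (cos \<theta>))\<^sup>2 * a + of_real (cos \<theta>) * of_real (sin \<theta>) * (u * c + cnj u * d)
            + (of_real (sin \<theta>))\<^sup>2 * (cnj u * u) * b"
        by (simp add: z_def bounded_clinear_add[OF T] bounded_clinear_scaleC[OF T] abcd
            cinner_add_left cinner_add_right cinner_scaleC_left cinner_scaleC_right
            power2_eq_square algebra_simps)
      also have "\<dots> = a + of_real (\<phi> \<theta>) * (b - a)"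
        unfolding uu cs cross by (simp add: \<phi>_def algebra_simps)
      finally show ?thesis by (simp add: \<theta> algebra_simps)
    qed
    ultimately show ?thesis
      using that[of z] by (simp add: abcd)
  qed
qed

text \<open>A further vector \<open>f i\<close> is orthogonal to the span that contains the vector already found for
  \<open>A\<close>, so the two can be combined by \<open>numerical_range_segment\<close>; the weight \<open>1 / (card A + 1)\<close> on
  \<open>f i\<close> turns the average over \<open>A\<close> into the average over \<open>insert i A\<close>.\<close>

lemma diagonal_average_in_numerical_range:
  fixes T :: "'a::complex_inner \<Rightarrow> 'a"
  assumes T: "bounded_clinear T" and "finite A" "A \<noteq> {}" "orthonormal_on A f"
  obtains z where "z \<in> cspan (f ` A)" "norm z = 1"
    "of_nat (card A) * cinner z (T z) = (\<Sum>j\<in>A. cinner (f j) (T (f j)))"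
proof -
  have "\<exists>z\<in>cspan (f ` A). norm z = 1 \<and>
      of_nat (card A) * cinner z (T z) = (\<Sum>j\<in>A. cinner (f j) (T (f j)))"
    using assms(2-4)
  proof (induction A rule: finite_ne_induct)
    case (singleton i)
    then show ?case
      by (intro bexI[of _ "f i"]) (auto simp: orthonormal_on_def norm_eq_sqrt_cinner complex_vector.span_base)
  next
    case (insert i A)
    have "orthonormal_on A f"
      using insert.prems by (auto simp: orthonormal_on_def)
    then obtain x where x: "x \<in> cspan (f ` A)" "norm x = 1"
      and xT: "of_nat (card A) * cinner x (T x) = (\<Sum>j\<in>A. cinner (f j) (T (f j)))"
      using insert.IH by blast
    have fi: "norm (f i) = 1"
      using insert.prems by (auto simp: orthonormal_on_def norm_eq_sqrt_cinner)
    have "cinner x (f i) = 0"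
    proof (rule cspan_orthogonal[OF _ x(1)])
      show "f i \<in> cspan {f i}" by (simp add: complex_vector.span_base)
      show "cinner a b = 0" if "a \<in> f ` A" "b \<in> {f i}" for a b
        using that insert.prems insert.hyps by (force simp: orthonormal_on_def)
    qed
    then obtain z where z: "z \<in> cspan {x, f i}" "norm z = 1"
      and zT: "cinner z (T z) = of_real (1 - 1 / real (Suc (card A))) * cinner x (T x)
                 + of_real (1 / real (Suc (card A))) * cinner (f i) (T (f i))"
      using numerical_range_segment[OF T x(2) fi, of "1 / real (Suc (card A))"] by auto
    have "cspan {x, f i} \<subseteq> cspan (f ` insert i A)"
    proof (rule complex_vector.span_minimal)
      show "{x, f i} \<subseteq> cspan (f ` insert i A)"
        using x(1) complex_vector.span_mono[of "f ` A" "f ` insert i A"]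
        by (auto intro: complex_vector.span_base)
    qed simp
    moreover have "of_nat (card (insert i A)) * cinner z (T z)
        = (\<Sum>j\<in>insert i A. cinner (f j) (T (f j)))"
    proof -
      define m where "m = (of_nat (Suc (card A)) :: complex)"
      have m: "m \<noteq> 0" "m - 1 = of_nat (card A)"
        unfolding m_def by (simp_all del: of_nat_Suc) simp
      have "cinner z (T z) = (1 - 1 / m) * cinner x (T x) + (1 / m) * cinner (f i) (T (f i))"
        using zT by (simp add: m_def)
      then have "m * cinner z (T z) = (m - 1) * cinner x (T x) + cinner (f i) (T (f i))"
        using m(1) by (simp add: field_simps)
      then show ?thesis
        using insert.hyps by (simp add: m(2) xT) (simp add: m_def add.commute)
    qed
    ultimately show ?case using z by blast
  qed
  then show ?thesis using that by blast
qed

text \<open>Dyadic blocks make each block as long as everything before it. This keeps the factor by which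
  a block average depends on the means bounded, so that the averages converge along with the
  means.\<close>

lemma essential_numerical_range_if_diagonal_mean:
  fixes T :: "'a::complex_inner \<Rightarrow> 'a"
  assumes T: "bounded_clinear T" and f: "orthonormal_system f" and lim: "diagonal_mean T f \<longlonglongrightarrow> \<mu>"
  shows "\<mu> \<in> essential_numerical_range T"
proof -
  define A where "A k = {2 ^ k..<2 ^ Suc k :: nat}" for k
  define S where "S n = (\<Sum>j<n. cinner (f j) (T (f j)))" for n
  have "\<exists>z\<in>cspan (f ` A k). norm z = 1 \<and>
      of_nat (card (A k)) * cinner z (T z) = (\<Sum>j\<in>A k. cinner (f j) (T (f j)))" for k
    using diagonal_average_in_numerical_range[OF T _ _ orthonormal_system_on[OF f], of "A k"]
    by (auto simp: A_def)
  then obtain g where g: "\<And>k. g k \<in> cspan (f ` A k)" "\<And>k. norm (g k) = 1"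
    "\<And>k. of_nat (card (A k)) * cinner (g k) (T (g k)) = (\<Sum>j\<in>A k. cinner (f j) (T (f j)))"
    by metis
  have disj: "i < j" if "i \<in> A m" "j \<in> A n" "m < n" for i j m n
  proof -
    have "i < 2 ^ Suc m" using that by (simp add: A_def)
    also have "\<dots> \<le> 2 ^ n" using that by (intro power_increasing) auto
    finally show ?thesis using that by (simp add: A_def)
  qed
  have "cinner (g m) (g n) = 0" if "m \<noteq> n" for m n
  proof (rule cspan_orthogonal[OF _ g(1) g(1)])
    fix a b assume "a \<in> f ` A m" "b \<in> f ` A n"
    then show "cinner a b = 0"
      using f disj that by (auto simp: orthonormal_system_def) (metis linorder_neqE_nat less_irrefl)
  qed
  then have orth: "orthonormal_system g"
    by (auto simp: orthonormal_system_def cinner_self g(2))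
  have gT: "cinner (g k) (T (g k)) = 2 * diagonal_mean T f (2 ^ Suc k) - diagonal_mean T f (2 ^ k)" for k
  proof -
    have "S (2 ^ Suc k) = S (2 ^ k) + (\<Sum>j\<in>A k. cinner (f j) (T (f j)))"
      unfolding S_def A_def lessThan_atLeast0 by (subst sum.atLeastLessThan_concat) auto
    then have "2 ^ k * cinner (g k) (T (g k)) = S (2 ^ Suc k) - S (2 ^ k)"
      using g(3)[of k] by (simp add: A_def)
    then show ?thesis
      by (simp add: diagonal_mean_def S_def[symmetric] field_simps)
  qed
  have pow: "filterlim (\<lambda>k. 2 ^ k :: nat) at_top sequentially"
    by (intro filterlim_subseq strict_monoI) simp
  have "(\<lambda>k. cinner (g k) (T (g k))) \<longlonglongrightarrow> 2 * \<mu> - \<mu>"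
    unfolding gT
    by (intro tendsto_intros filterlim_compose[OF lim] pow
        filterlim_compose[OF pow filterlim_Suc])
  then show ?thesis
    using orth by (auto simp: essential_numerical_range_def)
qed

section \<open>Unit vectors orthogonal to a finite family\<close>

text \<open>The difference of the two forms is
  \<open>cinner (g n - f n) (T (g n)) + cinner (f n) (T (g n - f n))\<close>, which the boundedness of \<open>T\<close>
  controls.\<close>

lemma quadratic_form_diff_tendsto:
  fixes T :: "'a::complex_inner \<Rightarrow> 'a"
  assumes T: "bounded_clinear T" and f: "\<And>n. norm (f n) = 1"
    and fg: "(\<lambda>n. norm (g n - f n)) \<longlonglongrightarrow> 0"
    and lim: "(\<lambda>n. cinner (f n) (T (f n))) \<longlonglongrightarrow> \<mu>"
  shows "(\<lambda>n. cinner (g n) (T (g n))) \<longlonglongrightarrow> \<mu>" "(\<lambda>n. norm (g n)) \<longlonglongrightarrow> 1"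
proof -
  obtain K where K: "0 \<le> K" "\<And>x. norm (T x) \<le> K * norm x"
    using bounded_clinear_bound[OF T] by blast
  have "(\<lambda>n. norm (g n) - 1) \<longlonglongrightarrow> 0"
  proof (rule tendsto_0_le[OF fg, of _ 1])
    show "\<forall>\<^sub>F n in sequentially. norm (norm (g n) - 1) \<le> norm (norm (g n - f n)) * 1"
      by (intro always_eventually allI) (use norm_triangle_ineq3 f in \<open>metis abs_norm_cancel mult_1_right real_norm_def\<close>)
  qed
  then show ng: "(\<lambda>n. norm (g n)) \<longlonglongrightarrow> 1"
    by (simp add: LIM_zero_iff)
  have "(\<lambda>n. cinner (g n) (T (g n)) - cinner (f n) (T (f n))) \<longlonglongrightarrow> 0"
  proof (rule Lim_null_comparison[where g = "\<lambda>n. norm (g n - f n) * (K * norm (g n)) + K * norm (g n - f n)"])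
    show "\<forall>\<^sub>F n in sequentially. cmod (cinner (g n) (T (g n)) - cinner (f n) (T (f n)))
        \<le> norm (g n - f n) * (K * norm (g n)) + K * norm (g n - f n)"
    proof (intro always_eventually allI)
      fix n
      have "cinner (g n) (T (g n)) - cinner (f n) (T (f n))
          = cinner (g n - f n) (T (g n)) + cinner (f n) (T (g n - f n))"
        by (simp add: bounded_clinear_diff[OF T] cinner_diff_left cinner_diff_right)
      also have "cmod \<dots> \<le> norm (g n - f n) * norm (T (g n)) + norm (f n) * norm (T (g n - f n))"
        by (intro norm_triangle_mono cauchy_schwarz)
      also have "\<dots> \<le> norm (g n - f n) * (K * norm (g n)) + norm (f n) * (K * norm (g n - f n))"
        by (intro add_mono mult_left_mono K) auto
      finally show "cmod (cinner (g n) (T (g n)) - cinner (f n) (T (f n)))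
          \<le> norm (g n - f n) * (K * norm (g n)) + K * norm (g n - f n)"
        by (simp add: f)
    qed
    show "(\<lambda>n. norm (g n - f n) * (K * norm (g n)) + K * norm (g n - f n)) \<longlonglongrightarrow> 0"
      using tendsto_add[OF tendsto_mult[OF fg tendsto_mult[OF tendsto_const[of K] ng]]
          tendsto_mult[OF tendsto_const[of K] fg]] by simp
  qed
  from tendsto_add[OF this lim] show "(\<lambda>n. cinner (g n) (T (g n))) \<longlonglongrightarrow> \<mu>"
    by simp
qed

text \<open>Since the realising system is weakly null, projecting its members onto the orthogonal
  complement of the finite family changes them less and less; the normalised
  projections therefore give the same limit \<open>\<mu>\<close>.\<close>

lemma essential_numerical_range_orthogonal_unit:
  fixes T :: "'a::complex_inner \<Rightarrow> 'a"
  assumes T: "bounded_clinear T" and \<mu>: "\<mu> \<in> essential_numerical_range T"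
    and A: "finite A" "orthonormal_on A e" and "\<epsilon> > 0"
  obtains x where "norm x = 1" "\<And>i. i \<in> A \<Longrightarrow> cinner (e i) x = 0"
    "cmod (cinner x (T x) - \<mu>) < \<epsilon>"
proof -
  obtain f where f: "orthonormal_system f" and lim: "(\<lambda>n. cinner (f n) (T (f n))) \<longlonglongrightarrow> \<mu>"
    using \<mu> by (auto simp: essential_numerical_range_def)
  define g where "g n = f n - fourier_sum A e (f n)" for n
  define r where "r n = 1 / norm (g n)" for n
  have "(\<lambda>n. norm (g n - f n)) \<longlonglongrightarrow> 0"
  proof (rule Lim_null_comparison[where g = "\<lambda>n. \<Sum>i\<in>A. cmod (cinner (e i) (f n)) * norm (e i)"])
    have "norm (fourier_sum A e (f n)) \<le> (\<Sum>i\<in>A. cmod (cinner (e i) (f n)) * norm (e i))" for n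
      unfolding fourier_sum_def by (rule order_trans[OF norm_sum]) (simp add: norm_scaleC)
    then show "\<forall>\<^sub>F n in sequentially. norm (norm (g n - f n))
        \<le> (\<Sum>i\<in>A. cmod (cinner (e i) (f n)) * norm (e i))"
      by (simp add: g_def)
    show "(\<lambda>n. \<Sum>i\<in>A. cmod (cinner (e i) (f n)) * norm (e i)) \<longlonglongrightarrow> 0"
      by (intro tendsto_null_sum tendsto_mult_left_zero tendsto_norm_zero orthonormal_weakly_null f)
  qed
  note g = quadratic_form_diff_tendsto[OF T orthonormal_system_norm[OF f] this lim]
  have "r \<longlonglongrightarrow> 1"
    unfolding r_def using tendsto_divide[OF tendsto_const g(2), of 1] by simp
  then have "(\<lambda>n. of_real ((r n)\<^sup>2) * cinner (g n) (T (g n))) \<longlonglongrightarrow> of_real (1\<^sup>2) * \<mu>"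
    by (intro tendsto_intros g(1))
  then have "(\<lambda>n. of_real ((r n)\<^sup>2) * cinner (g n) (T (g n))) \<longlonglongrightarrow> \<mu>"
    by simp
  then have "\<forall>\<^sub>F n in sequentially. dist (of_real ((r n)\<^sup>2) * cinner (g n) (T (g n))) \<mu> < \<epsilon>"
    using \<open>\<epsilon> > 0\<close> by (rule tendstoD)
  moreover have "\<forall>\<^sub>F n in sequentially. norm (g n) > 0"
    using g(2) by (rule order_tendstoD) simp
  ultimately have "\<forall>\<^sub>F n in sequentially. norm (g n) > 0 \<and>
      dist (of_real ((r n)\<^sup>2) * cinner (g n) (T (g n))) \<mu> < \<epsilon>"
    by eventually_elim simp
  then obtain n where n: "g n \<noteq> 0"
    "dist (of_real ((r n)\<^sup>2) * cinner (g n) (T (g n))) \<mu> < \<epsilon>"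
    using eventually_happens by fastforce
  define x where "x = of_real (r n) *\<^sub>C g n"
  show ?thesis
  proof (rule that)
    show "norm x = 1"
      unfolding x_def r_def by (rule norm_normalize[OF n(1)])
    show "cinner (e i) x = 0" if "i \<in> A" for i
      using cinner_fourier_residual[OF A that] by (simp add: x_def g_def cinner_scaleC_right)
    show "cmod (cinner x (T x) - \<mu>) < \<epsilon>"
      using n(2) unfolding x_def cinner_scaleC_quadratic[OF T] by (simp add: dist_norm)
  qed
qed

text \<open>A Gram--Schmidt step for \<open>y\<close>. The spare vector \<open>u\<close> serves as \<open>x\<close> when \<open>y\<close> already lies in
  the span and its residual cannot be normalised.\<close>

lemma orthogonal_unit_extending_span:
  assumes A: "finite A" "orthonormal_on A e"
    and u: "norm u = 1" "\<And>i. i \<in> A \<Longrightarrow> cinner (e i) u = 0"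
  obtains x where "norm x = 1" "\<And>i. i \<in> A \<Longrightarrow> cinner (e i) x = 0" "y \<in> cspan (insert x (e ` A))"
proof -
  define p where "p = fourier_sum A e y"
  have p: "p \<in> cspan (insert x (e ` A))" for x
    unfolding p_def using fourier_sum_in_cspan complex_vector.span_mono[of "e ` A" "insert x (e ` A)"] by blast
  show ?thesis
  proof (cases "y = p")
    case True
    with p u that[of u] show ?thesis by simp
  next
    case False
    define x where "x = of_real (1 / norm (y - p)) *\<^sub>C (y - p)"
    have "y = p + of_real (norm (y - p)) *\<^sub>C x"
      using False by (simp add: x_def scaleC_scaleC scaleC_one)
    then have "y \<in> cspan (insert x (e ` A))"
      by (metis p complex_vector.span_add complex_vector.span_scale complex_vector.span_base insertI1)
    moreover have "norm x = 1"
      unfolding x_def using False by (intro norm_normalize) simp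
    moreover have "cinner (e i) x = 0" if "i \<in> A" for i
      using cinner_fourier_residual[OF A that, of y] by (simp add: x_def p_def cinner_scaleC_right)
    ultimately show ?thesis using that by blast
  qed
qed

section \<open>Means along sets of density one\<close>

text \<open>In the mean of \<open>norm (a j - l)\<close>, the indices below some \<open>N\<close> and those in \<open>S\<close> contribute at
  most \<open>C\<close> each, and there are only \<open>o(n)\<close> of them; all others contribute less than
  \<open>\<epsilon> / 2\<close>.\<close>

lemma mean_tendsto_off_density_zero:
  fixes a :: "nat \<Rightarrow> 'b::real_normed_field"
  assumes dens: "(\<lambda>n. real (card (S \<inter> {..<n})) / real n) \<longlonglongrightarrow> 0"
    and C: "\<And>n. norm (a n - l) \<le> C"
    and lim: "\<And>\<epsilon>. \<epsilon> > 0 \<Longrightarrow> \<forall>\<^sub>F n in sequentially. n \<notin> S \<longrightarrow> norm (a n - l) < \<epsilon>"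
  shows "(\<lambda>n. 1 / of_nat n * (\<Sum>j<n. a j)) \<longlonglongrightarrow> l"
proof (rule tendstoI)
  fix \<epsilon> :: real assume "\<epsilon> > 0"
  have "C \<ge> 0" using C[of 0] norm_ge_zero order_trans by blast
  obtain N where N: "\<And>n. n \<ge> N \<Longrightarrow> n \<notin> S \<Longrightarrow> norm (a n - l) < \<epsilon> / 2"
    using lim[of "\<epsilon> / 2"] \<open>\<epsilon> > 0\<close> by (auto simp: eventually_sequentially)
  have "(\<lambda>n. C * real N / real n + C * (real (card (S \<inter> {..<n})) / real n)) \<longlonglongrightarrow> 0 + C * 0"
    by (intro tendsto_intros dens real_tendsto_divide_at_top[OF tendsto_const] filterlim_real_sequentially)
  then have "\<forall>\<^sub>F n in sequentially. C * real N / real n + C * (real (card (S \<inter> {..<n})) / real n) < \<epsilon> / 2"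
    by (rule order_tendstoD) (use \<open>\<epsilon> > 0\<close> in simp)
  with eventually_gt_at_top[of 0]
  show "\<forall>\<^sub>F n in sequentially. dist (1 / of_nat n * (\<Sum>j<n. a j)) l < \<epsilon>"
  proof eventually_elim
    case (elim n)
    have "norm (a j - l) \<le> \<epsilon> / 2 + (if j \<in> {..<N} then C else 0) + (if j \<in> S then C else 0)" for j
      using C[of j] N[of j] \<open>C \<ge> 0\<close> \<open>\<epsilon> > 0\<close> by (cases "j < N"; cases "j \<in> S") auto
    then have "(\<Sum>j<n. norm (a j - l))
        \<le> (\<Sum>j<n. \<epsilon> / 2 + (if j \<in> {..<N} then C else 0) + (if j \<in> S then C else 0))"
      by (rule sum_mono)
    also have "\<dots> = n * (\<epsilon> / 2) + C * card ({..<n} \<inter> {..<N}) + C * card (S \<inter> {..<n})"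
      by (simp add: sum.distrib sum.inter_restrict[symmetric] Int_commute mult.commute del: lessThan_iff)
    also have "\<dots> \<le> n * (\<epsilon> / 2) + C * N + C * card (S \<inter> {..<n})"
      using card_mono[of "{..<N}" "{..<n} \<inter> {..<N}"] \<open>C \<ge> 0\<close> by (simp add: mult_left_mono)
    also have "\<dots> = n * (\<epsilon> / 2 + (C * real N / real n + C * (real (card (S \<inter> {..<n})) / real n)))"
      using elim(1) by (simp add: field_simps)
    also have "\<dots> < n * \<epsilon>"
    proof (rule mult_strict_left_mono)
      show "\<epsilon> / 2 + (C * real N / real n + C * (real (card (S \<inter> {..<n})) / real n)) < \<epsilon>"
        using elim(2) by linarith
    qed (use elim(1) in simp)
    finally have sum: "(\<Sum>j<n. norm (a j - l)) < n * \<epsilon>" .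
    have "1 / of_nat n * (\<Sum>j<n. a j) - l = 1 / of_nat n * (\<Sum>j<n. a j - l)"
      using elim(1) by (simp add: sum_subtractf field_simps)
    then have "norm (1 / of_nat n * (\<Sum>j<n. a j) - l) = norm (\<Sum>j<n. a j - l) / n"
      by (simp add: norm_mult norm_divide)
    also have "\<dots> \<le> (\<Sum>j<n. norm (a j - l)) / n"
      by (intro divide_right_mono norm_sum) simp
    also have "\<dots> < \<epsilon>"
      using sum elim(1) by (simp add: field_simps)
    finally show ?case by (simp add: dist_norm)
  qed
qed

lemma squares_density_zero:
  "(\<lambda>n. real (card (range (\<lambda>k. k\<^sup>2) \<inter> {..<n})) / real n) \<longlonglongrightarrow> 0"
proof (rule Lim_null_comparison[where g = "\<lambda>n. 1 / sqrt (real n) + 1 / real n"])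
  show "\<forall>\<^sub>F n in sequentially. norm (real (card (range (\<lambda>k. k\<^sup>2) \<inter> {..<n})) / real n)
      \<le> 1 / sqrt (real n) + 1 / real n"
    using eventually_gt_at_top[of 0]
  proof eventually_elim
    case (elim n)
    define m where "m = nat \<lceil>sqrt (real n)\<rceil>"
    have "range (\<lambda>k. k\<^sup>2) \<inter> {..<n} \<subseteq> (\<lambda>k. k\<^sup>2) ` {..<m}"
    proof clarsimp
      fix k :: nat assume "k\<^sup>2 < n"
      then have "real k < sqrt (real n)"
        by (metis of_nat_less_iff of_nat_power real_less_rsqrt)
      then show "k\<^sup>2 \<in> (\<lambda>k. k\<^sup>2) ` {..<m}"
        unfolding m_def by (intro imageI) (simp, linarith)
    qed
    then have "card (range (\<lambda>k. k\<^sup>2) \<inter> {..<n}) \<le> m"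
      by (metis card_image_le card_lessThan card_mono finite_imageI finite_lessThan order_trans)
    moreover have "real m \<le> sqrt (real n) + 1"
      unfolding m_def by simp
    ultimately have "real (card (range (\<lambda>k. k\<^sup>2) \<inter> {..<n})) / real n \<le> (sqrt (real n) + 1) / real n"
      by (intro divide_right_mono) auto
    also have "\<dots> = 1 / sqrt (real n) + 1 / real n"
      by (simp add: add_divide_distrib sqrt_divide_self_eq inverse_eq_divide)
    finally show ?case by simp
  qed
  have "filterlim (\<lambda>n. sqrt (real n)) at_top sequentially"
    by (intro filterlim_compose[OF sqrt_at_top] filterlim_real_sequentially)
  then have "(\<lambda>n. 1 / sqrt (real n) + 1 / real n) \<longlonglongrightarrow> 0 + 0"
    by (intro tendsto_add real_tendsto_divide_at_top[OF tendsto_const] filterlim_real_sequentially)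
  then show "(\<lambda>n. 1 / sqrt (real n) + 1 / real n) \<longlonglongrightarrow> 0" by simp
qed

section \<open>Orthonormal bases with a prescribed diagonal mean\<close>

text \<open>Square positions are used for density of the span and the others for the limit. Any infinite
  set of positions of density zero would do in place of the squares.\<close>

lemma orthonormal_basis_with_diagonal_mean:
  fixes T :: "'a::complex_inner \<Rightarrow> 'a"
  assumes sep: "separable_space (euclidean :: 'a topology)"
    and T: "bounded_clinear T" and \<mu>: "\<mu> \<in> essential_numerical_range T"
  obtains e where "orthonormal_basis e" "diagonal_mean T e \<longlonglongrightarrow> \<mu>"
proof -
  obtain D :: "'a set" where D: "countable D" "closure D = UNIV"
    using sep by (auto simp: separable_space_def)
  then have "D \<noteq> {}" by auto
  define d where "d = from_nat_into D"
  have d: "range d = D"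
    unfolding d_def using D(1) \<open>D \<noteq> {}\<close> by (simp add: range_from_nat_into)
  define P where "P e n x \<longleftrightarrow> norm x = 1 \<and> (\<forall>i<n. cinner (e i) x = 0) \<and>
      (\<forall>k. n = k\<^sup>2 \<longrightarrow> d k \<in> cspan (insert x (e ` {..<n}))) \<and>
      (n \<notin> range (\<lambda>k. k\<^sup>2) \<longrightarrow> cmod (cinner x (T x) - \<mu>) < 1 / real (Suc n))"
    for e :: "nat \<Rightarrow> 'a" and n x
  have "\<exists>e. \<forall>n. P e n (e n)"
  proof (rule dependent_wellorder_choice)
    fix r :: 'a and f g :: "nat \<Rightarrow> 'a" and n
    assume "\<And>i. i < n \<Longrightarrow> f i = g i"
    then have "f ` {..<n} = g ` {..<n}" "\<And>i. i < n \<Longrightarrow> f i = g i"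
      by auto
    then show "P f n r = P g n r"
      unfolding P_def by auto
  next
    fix n and e :: "nat \<Rightarrow> 'a"
    assume prev: "\<And>i. i < n \<Longrightarrow> P e i (e i)"
    have A: "orthonormal_on {..<n} e"
      unfolding orthonormal_on_def
    proof (intro ballI)
      fix i j assume "i \<in> {..<n}" "j \<in> {..<n}"
      then have "norm (e i) = 1" "i < j \<Longrightarrow> cinner (e i) (e j) = 0" "j < i \<Longrightarrow> cinner (e j) (e i) = 0"
        using prev[of i] prev[of j] by (auto simp: P_def)
      then show "cinner (e i) (e j) = (if i = j then 1 else 0)"
        using cinner_orthogonal_sym[of "e i" "e j"] by (cases i j rule: linorder_cases) (auto simp: cinner_self)
    qed
    obtain u where u: "norm u = 1" "\<And>i. i \<in> {..<n} \<Longrightarrow> cinner (e i) u = 0"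
      "cmod (cinner u (T u) - \<mu>) < 1 / real (Suc n)"
      using essential_numerical_range_orthogonal_unit[OF T \<mu> finite_lessThan A, of "1 / real (Suc n)"]
      by auto
    show "\<exists>x. P e n x"
    proof (cases "n \<in> range (\<lambda>k. k\<^sup>2)")
      case True
      then obtain k where k: "n = k\<^sup>2" by auto
      obtain x where "norm x = 1" "\<And>i. i \<in> {..<n} \<Longrightarrow> cinner (e i) x = 0"
        "d k \<in> cspan (insert x (e ` {..<n}))"
        using orthogonal_unit_extending_span[OF finite_lessThan A u(1,2), of "d k"] by auto
      moreover have "k' = k" if "n = k'\<^sup>2" for k'
        using that k by (simp add: power2_eq_iff_nonneg)
      ultimately show ?thesis
        using True by (auto simp: P_def)
    next
      case False
      then show ?thesis using u by (auto simp: P_def)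
    qed
  qed
  then obtain e where e: "\<And>n. P e n (e n)" by blast
  have norm_e: "norm (e n) = 1" and less: "i < n \<Longrightarrow> cinner (e i) (e n) = 0" for i n
    using e[of n] by (auto simp: P_def)
  have on: "orthonormal_system e"
    unfolding orthonormal_system_def
  proof (intro allI)
    fix i j
    show "cinner (e i) (e j) = (if i = j then 1 else 0)"
      using less[of i j] less[of j i] cinner_orthogonal_sym[of "e i" "e j"]
      by (cases i j rule: linorder_cases) (auto simp: cinner_self norm_e)
  qed
  have "d k \<in> cspan (range e)" for k
  proof -
    have "d k \<in> cspan (insert (e (k\<^sup>2)) (e ` {..<k\<^sup>2}))"
      using e[of "k\<^sup>2"] by (simp add: P_def)
    then show ?thesis
      using complex_vector.span_mono[of "insert (e (k\<^sup>2)) (e ` {..<k\<^sup>2})" "range e"] by auto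
  qed
  then have "closure D \<subseteq> closure (cspan (range e))"
    using d by (intro closure_mono) auto
  then have "orthonormal_basis e"
    using on D(2) by (auto simp: orthonormal_basis_def)
  moreover have "diagonal_mean T e \<longlonglongrightarrow> \<mu>"
  proof -
    obtain K where K: "\<And>x. norm (T x) \<le> K * norm x"
      using bounded_clinear_bound[OF T] by blast
    show ?thesis
      unfolding diagonal_mean_def
    proof (rule mean_tendsto_off_density_zero[OF squares_density_zero])
      fix n
      have "cmod (cinner (e n) (T (e n))) \<le> K"
        using cauchy_schwarz[of "e n" "T (e n)"] K[of "e n"] by (simp add: norm_e)
      then show "cmod (cinner (e n) (T (e n)) - \<mu>) \<le> K + cmod \<mu>"
        using norm_triangle_ineq4[of "cinner (e n) (T (e n))" \<mu>] by linarith
    next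
      fix \<epsilon> :: real assume "\<epsilon> > 0"
      then have "\<forall>\<^sub>F n in sequentially. inverse (real (Suc n)) < \<epsilon>"
        using order_tendstoD(2)[OF LIMSEQ_inverse_real_of_nat] by blast
      then show "\<forall>\<^sub>F n in sequentially. n \<notin> range (\<lambda>k. k\<^sup>2) \<longrightarrow> cmod (cinner (e n) (T (e n)) - \<mu>) < \<epsilon>"
      proof eventually_elim
        case (elim n)
        then show ?case
          using e[of n] by (auto simp: P_def inverse_eq_divide)
      qed
    qed
  qed
  ultimately show ?thesis using that by blast
qed

theorem proposition3p9:
  fixes T :: "'a::chilbert_space \<Rightarrow> 'a" and \<mu> :: complex
  assumes "infinite_dimensional TYPE('a)"
    and "separable_space (euclidean :: 'a topology)"
    and "bounded_clinear T"
  shows "(\<mu> \<in> essential_numerical_range T \<longleftrightarrow>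
            (\<exists>f. orthonormal_system f \<and> diagonal_mean T f \<longlonglongrightarrow> \<mu>)) \<and>
         ((\<exists>f. orthonormal_system f \<and> diagonal_mean T f \<longlonglongrightarrow> \<mu>) \<longleftrightarrow>
            (\<exists>e. orthonormal_basis e \<and> diagonal_mean T e \<longlonglongrightarrow> \<mu>))"
proof -
  have "\<mu> \<in> essential_numerical_range T"
    if "orthonormal_system f" "diagonal_mean T f \<longlonglongrightarrow> \<mu>" for f
    using essential_numerical_range_if_diagonal_mean[OF assms(3) that] .
  moreover have "\<exists>e. orthonormal_basis e \<and> diagonal_mean T e \<longlonglongrightarrow> \<mu>"
    if "\<mu> \<in> essential_numerical_range T"
    using orthonormal_basis_with_diagonal_mean[OF assms(2,3) that] by blast
  moreover have "orthonormal_system e" if "orthonormal_basis e" for e :: "nat \<Rightarrow> 'a"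
    using that by (simp add: orthonormal_basis_def)
  ultimately show ?thesis by blast
qed

end
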